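(* Let $r\ge1$ and $\kappa\in\{B,C\}$, and let $\mathcal G_{\kappa,r}=\langle A^\kappa_{1,r},A_2\rangle\subset GL(\Lambda)$ be the group defined in the context. For every finite-index subgroup $H\subset\mathcal G_{\kappa,r}$, $$\Bigl(\textstyle\bigwedge^2\Lambda^*\Bigr)^H=\mathbb Z\,\widetilde q_{\kappa,r},\qquad \Bigl(\textstyle\bigwedge^2\Lambda^*_{\mathbb R}\Bigr)^H=\mathbb R\,\widetilde q_{\kappa,r},$$ $$\Lambda^H=\mathbb Z\delta,\qquad(\Lambda^* )^H=\mathbb Z\gamma^*,$$ $$\operatorname{Cent}_{GL_4(\mathbb Z)}(H)=\{\varepsilon I+nE_{41}:\varepsilon=\pm1,\ n\in\mathbb Z\}.$$ Thus finite-index restriction preserves the invariant alternating line and the integral centralizer.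
   Context: $\Lambda=\mathbb Z\gamma\oplus\mathbb Zu\oplus\mathbb Zw\oplus\mathbb Z\delta\cong\mathbb Z^4$ (column vectors in this ordered basis), with dual basis $\gamma^*,u^*,w^*,\delta^*$ of $\Lambda^*=\operatorname{Hom}(\Lambda,\mathbb Z)$; $\Lambda^*_{\mathbb R}=\Lambda^*\otimes\mathbb R$. Put $$A^B_{1,r}=\begin{pmatrix}1&0&0&0\\0&0&1&0\\-2r&-1&0&0\\-r&0&-1&1\end{pmatrix},\quad A^C_{1,r}=\begin{pmatrix}1&0&0&0\\0&0&1&0\\-3r&-1&-1&0\\-r&0&-1&1\end{pmatrix},\quad A_2=\begin{pmatrix}1&0&0&0\\0&1&-1&0\\0&1&0&0\\0&0&0&1\end{pmatrix}.$$ With $s_B=2$, $s_C=3$, put $\widetilde q_{\kappa,r}=s_\kappa r\,\gamma^*\wedge\delta^*+u^*\wedge w^*$. $H$ acts on $\Lambda^*$ and its exterior powers contragrediently. $E_{41}$ is the $4\times4$ matrix with a single $1$ in row four, column one. *)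

theory Defs
  imports "HOL-Analysis.Analysis" "HOL-Algebra.Coset" "HOL-Algebra.Generated_Groups"
begin

text \<open>
  The lattice \<open>\<Lambda>\<close> is \<^typ>\<open>int^4\<close>, and its extension of scalars to a commutative ring \<open>'a\<close> is
  \<open>'a^4\<close>; coordinates 1, 2, 3, 4 belong to the basis vectors \<open>\<gamma>, u, w, \<delta>\<close> in this order.
\<close>

definition GL4Z :: "(int^4^4) monoid" where
  "GL4Z = \<lparr>carrier = {A. invertible A}, mult = (**), one = mat 1\<rparr>"

datatype kappa = Type_B | Type_C

fun s_coeff :: "kappa \<Rightarrow> int" where
  "s_coeff Type_B = 2"
| "s_coeff Type_C = 3"

fun A1 :: "kappa \<Rightarrow> int \<Rightarrow> int^4^4" where
  "A1 Type_B r = vector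
   [vector [1, 0, 0, 0],
    vector [0, 0, 1, 0],
    vector [- 2 * r, - 1, 0, 0],
    vector [- r, 0, - 1, 1]]"
| "A1 Type_C r = vector
   [vector [1, 0, 0, 0],
    vector [0, 0, 1, 0],
    vector [- 3 * r, - 1, - 1, 0],
    vector [- r, 0, - 1, 1]]"

definition A2 :: "int^4^4" where
  "A2 = vector [vector [1, 0, 0, 0],
                vector [0, 1, - 1, 0],
                vector [0, 1, 0, 0],
                vector [0, 0, 0, 1]]"

definition calG :: "kappa \<Rightarrow> int \<Rightarrow> (int^4^4) set" where
  "calG \<kappa> r = generate GL4Z {A1 \<kappa> r, A2}"

definition finite_index_subgroup :: "'b set \<Rightarrow> ('b, 'm) monoid_scheme \<Rightarrow> bool" where
  "finite_index_subgroup H K \<longleftrightarrow> subgroup H K \<and> finite (rcosets\<^bsub>K\<^esub> H)"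

definition centralizer :: "('b, 'm) monoid_scheme \<Rightarrow> 'b set \<Rightarrow> 'b set" where
  "centralizer K H = {a \<in> carrier K. \<forall>h\<in>H. a \<otimes>\<^bsub>K\<^esub> h = h \<otimes>\<^bsub>K\<^esub> a}"

definition E41 :: "int^4^4" where
  "E41 = (\<chi> i j. if i = 4 \<and> j = 1 then 1 else 0)"


definition dual :: "('a::comm_ring_1^4 \<Rightarrow> 'a) set" where
  "dual = {f. module_hom (*s) (*) f}"

definition coord :: "4 \<Rightarrow> 'a::comm_ring_1^4 \<Rightarrow> 'a" where
  "coord i x = x $ i"

abbreviation \<gamma>_star :: "'a::comm_ring_1^4 \<Rightarrow> 'a" where "\<gamma>_star \<equiv> coord 1"
abbreviation u_star :: "'a::comm_ring_1^4 \<Rightarrow> 'a" where "u_star \<equiv> coord 2"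
abbreviation w_star :: "'a::comm_ring_1^4 \<Rightarrow> 'a" where "w_star \<equiv> coord 3"
abbreviation \<delta>_star :: "'a::comm_ring_1^4 \<Rightarrow> 'a" where "\<delta>_star \<equiv> coord 4"

abbreviation \<delta>_vec :: "int^4" where "\<delta>_vec \<equiv> axis 4 1"

text \<open>
  The exterior square of the dual of the free module \<open>'a^4\<close> is taken, as usual, to consist of the
  alternating bilinear forms on \<open>'a^4\<close>, with the wedge of two functionals normalised without
  a factor 1/2. The lemma \<open>ext_square_basis\<close> below confirms that the wedges of the
  dual basis vectors form a basis.
\<close>

definition ext_square_dual :: "('a::comm_ring_1^4 \<Rightarrow> 'a^4 \<Rightarrow> 'a) set" where
  "ext_square_dual = {\<omega>. (\<forall>x. module_hom (*s) (*) (\<omega> x))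
                       \<and> (\<forall>y. module_hom (*s) (*) (\<lambda>x. \<omega> x y))
                       \<and> (\<forall>x. \<omega> x x = 0)}"

definition wedge :: "('a::comm_ring_1^4 \<Rightarrow> 'a) \<Rightarrow> ('a^4 \<Rightarrow> 'a) \<Rightarrow> 'a^4 \<Rightarrow> 'a^4 \<Rightarrow> 'a"
    (infixl \<open>\<and>\<^sub>2\<close> 70) where
  "(f \<and>\<^sub>2 g) x y = f x * g y - f y * g x"

definition q_tilde :: "kappa \<Rightarrow> int \<Rightarrow> 'a::comm_ring_1^4 \<Rightarrow> 'a^4 \<Rightarrow> 'a" where
  "q_tilde \<kappa> r x y = of_int (s_coeff \<kappa> * r) * (\<gamma>_star \<and>\<^sub>2 \<delta>_star) x y + (u_star \<and>\<^sub>2 w_star) x y"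


definition act :: "int^4^4 \<Rightarrow> 'a::comm_ring_1^4 \<Rightarrow> 'a^4" where
  "act g x = (\<chi> i j. of_int (g $ i $ j)) *v x"

definition act_dual :: "int^4^4 \<Rightarrow> ('a::comm_ring_1^4 \<Rightarrow> 'a) \<Rightarrow> 'a^4 \<Rightarrow> 'a" where
  "act_dual g f x = f (act (matrix_inv g) x)"

definition act_ext_square ::
    "int^4^4 \<Rightarrow> ('a::comm_ring_1^4 \<Rightarrow> 'a^4 \<Rightarrow> 'a) \<Rightarrow> 'a^4 \<Rightarrow> 'a^4 \<Rightarrow> 'a" where
  "act_ext_square g \<omega> x y = \<omega> (act (matrix_inv g) x) (act (matrix_inv g) y)"

definition invariants :: "('g \<Rightarrow> 'm \<Rightarrow> 'm) \<Rightarrow> 'g set \<Rightarrow> 'm set \<Rightarrow> 'm set" where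
  "invariants \<alpha> H M = {m \<in> M. \<forall>h\<in>H. \<alpha> h m = m}"


lemma module_vec: "module ((*s) :: 'a::comm_ring_1 \<Rightarrow> 'a^4 \<Rightarrow> 'a^4)"
  by standard (auto simp: vec_eq_iff algebra_simps)

lemma module_mult: "module ((*) :: 'a::comm_ring_1 \<Rightarrow> 'a \<Rightarrow> 'a)"
  by standard (auto simp: algebra_simps)

lemma module_hom_iff_linear:
  fixes f :: "'a::comm_ring_1^4 \<Rightarrow> 'a"
  shows "module_hom (*s) (*) f \<longleftrightarrow>
    (\<forall>x y. f (x + y) = f x + f y) \<and> (\<forall>c x. f (c *s x) = c * f x)"
  using module_vec module_mult by (auto simp: module_hom_iff)

lemma coord_dual: "coord i \<in> dual"
  by (simp add: dual_def module_hom_iff_linear coord_def)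

lemma wedge_in_ext_square:
  assumes "f \<in> dual" "g \<in> dual"
  shows "f \<and>\<^sub>2 g \<in> ext_square_dual"
  using assms
  by (auto simp: dual_def ext_square_dual_def wedge_def module_hom_iff_linear algebra_simps)

lemma act_ext_square_wedge:
  "act_ext_square g (f1 \<and>\<^sub>2 f2) = act_dual g f1 \<and>\<^sub>2 act_dual g f2"
  by (simp add: fun_eq_iff act_ext_square_def act_dual_def wedge_def)

lemma vec4_expand:
  fixes x :: "'a::comm_ring_1^4"
  shows "x = x$1 *s axis 1 1 + x$2 *s axis 2 1 + x$3 *s axis 3 1 + x$4 *s axis 4 1"
  by (simp add: vec_eq_iff forall_4 axis_def)

lemma ext_square_basis:
  fixes \<omega> :: "'a::comm_ring_1^4 \<Rightarrow> 'a^4 \<Rightarrow> 'a"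
  shows "\<omega> \<in> ext_square_dual \<longleftrightarrow>
    (\<exists>!(c12, c13, c14, c23, c24, c34). \<forall>x y. \<omega> x y =
        c12 * (coord 1 \<and>\<^sub>2 coord 2) x y + c13 * (coord 1 \<and>\<^sub>2 coord 3) x y
      + c14 * (coord 1 \<and>\<^sub>2 coord 4) x y + c23 * (coord 2 \<and>\<^sub>2 coord 3) x y
      + c24 * (coord 2 \<and>\<^sub>2 coord 4) x y + c34 * (coord 3 \<and>\<^sub>2 coord 4) x y)"
    (is "_ \<longleftrightarrow> (\<exists>!(c12, c13, c14, c23, c24, c34). ?P c12 c13 c14 c23 c24 c34)")
proof
  let ?e = "\<lambda>i. axis i 1 :: 'a^4"
  have coeffs: "c12 = \<omega> (?e 1) (?e 2) \<and> c13 = \<omega> (?e 1) (?e 3) \<and> c14 = \<omega> (?e 1) (?e 4)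
      \<and> c23 = \<omega> (?e 2) (?e 3) \<and> c24 = \<omega> (?e 2) (?e 4) \<and> c34 = \<omega> (?e 3) (?e 4)"
    if "?P c12 c13 c14 c23 c24 c34" for c12 c13 c14 c23 c24 c34
    using that by (simp add: wedge_def coord_def axis_def)
  assume "\<omega> \<in> ext_square_dual"
  then have addr: "\<omega> x (y + z) = \<omega> x y + \<omega> x z" and addl: "\<omega> (x + y) z = \<omega> x z + \<omega> y z"
    and scr: "\<omega> x (c *s y) = c * \<omega> x y" and scl: "\<omega> (c *s x) y = c * \<omega> x y"
    and alt: "\<omega> x x = 0" for x y z c
    by (auto simp: ext_square_dual_def module_hom_iff_linear)
  have "\<omega> (x + y) (x + y) = \<omega> x y + \<omega> y x" for x y
    unfolding addr addl by (simp add: alt)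
  then have "\<omega> y x = - \<omega> x y" for x y
    by (metis alt add.commute eq_neg_iff_add_eq_0)
  then have sk: "\<omega> (?e 2) (?e 1) = - \<omega> (?e 1) (?e 2)" "\<omega> (?e 3) (?e 1) = - \<omega> (?e 1) (?e 3)"
    "\<omega> (?e 4) (?e 1) = - \<omega> (?e 1) (?e 4)" "\<omega> (?e 3) (?e 2) = - \<omega> (?e 2) (?e 3)"
    "\<omega> (?e 4) (?e 2) = - \<omega> (?e 2) (?e 4)" "\<omega> (?e 4) (?e 3) = - \<omega> (?e 3) (?e 4)"
    by blast+
  have "?P (\<omega> (?e 1) (?e 2)) (\<omega> (?e 1) (?e 3)) (\<omega> (?e 1) (?e 4))
           (\<omega> (?e 2) (?e 3)) (\<omega> (?e 2) (?e 4)) (\<omega> (?e 3) (?e 4))"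
  proof (intro allI)
    fix x y :: "'a^4"
    have "\<omega> x y = \<omega> (x$1 *s ?e 1 + x$2 *s ?e 2 + x$3 *s ?e 3 + x$4 *s ?e 4)
                    (y$1 *s ?e 1 + y$2 *s ?e 2 + y$3 *s ?e 3 + y$4 *s ?e 4)"
      using vec4_expand[of x] vec4_expand[of y] by argo
    then show "\<omega> x y =
        \<omega> (?e 1) (?e 2) * (coord 1 \<and>\<^sub>2 coord 2) x y + \<omega> (?e 1) (?e 3) * (coord 1 \<and>\<^sub>2 coord 3) x y
      + \<omega> (?e 1) (?e 4) * (coord 1 \<and>\<^sub>2 coord 4) x y + \<omega> (?e 2) (?e 3) * (coord 2 \<and>\<^sub>2 coord 3) x y
      + \<omega> (?e 2) (?e 4) * (coord 2 \<and>\<^sub>2 coord 4) x y + \<omega> (?e 3) (?e 4) * (coord 3 \<and>\<^sub>2 coord 4) x y"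
      by (simp only: addr addl scr scl alt sk wedge_def coord_def) (simp add: algebra_simps)
  qed
  note P = this
  show "\<exists>!(c12, c13, c14, c23, c24, c34). ?P c12 c13 c14 c23 c24 c34"
  proof (rule ex1I[of _ "(\<omega> (?e 1) (?e 2), \<omega> (?e 1) (?e 3), \<omega> (?e 1) (?e 4),
                          \<omega> (?e 2) (?e 3), \<omega> (?e 2) (?e 4), \<omega> (?e 3) (?e 4))"])
    fix c assume c: "case c of (c12, c13, c14, c23, c24, c34) \<Rightarrow> ?P c12 c13 c14 c23 c24 c34"
    obtain c12 c13 c14 c23 c24 c34 where c': "c = (c12, c13, c14, c23, c24, c34)"
      by (cases c)
    show "c = (\<omega> (?e 1) (?e 2), \<omega> (?e 1) (?e 3), \<omega> (?e 1) (?e 4),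
               \<omega> (?e 2) (?e 3), \<omega> (?e 2) (?e 4), \<omega> (?e 3) (?e 4))"
      using coeffs[OF c[unfolded c' prod.case]] unfolding c' prod.inject .
  qed (unfold prod.case, rule P)
next
  assume "\<exists>!(c12, c13, c14, c23, c24, c34). ?P c12 c13 c14 c23 c24 c34"
  then obtain c where "case c of (c12, c13, c14, c23, c24, c34) \<Rightarrow> ?P c12 c13 c14 c23 c24 c34"
    by blast
  then obtain c12 c13 c14 c23 c24 c34 where P: "?P c12 c13 c14 c23 c24 c34"
    by (cases c) blast
  show "\<omega> \<in> ext_square_dual"
    unfolding ext_square_dual_def module_hom_iff_linear mem_Collect_eq P[rule_format] wedge_def coord_def
    by (simp add: algebra_simps)
qed

lemma group_GL4Z: "group GL4Z"
proof (rule groupI)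
  fix A assume "A \<in> carrier GL4Z"
  then obtain A' where "A ** A' = mat 1" "A' ** A = mat 1"
    by (auto simp: GL4Z_def invertible_def)
  then show "\<exists>y\<in>carrier GL4Z. y \<otimes>\<^bsub>GL4Z\<^esub> A = \<one>\<^bsub>GL4Z\<^esub>"
    by (auto simp: GL4Z_def invertible_def intro!: bexI[of _ A'])
qed (auto simp: GL4Z_def invertible_mult matrix_mul_assoc invertible_def[of "mat 1"])

lemma vector_4 [simp]:
  "(vector [a, b, c, d] :: 'b::zero^4) $ 1 = a"
  "(vector [a, b, c, d] :: 'b::zero^4) $ 2 = b"
  "(vector [a, b, c, d] :: 'b::zero^4) $ 3 = c"
  "(vector [a, b, c, d] :: 'b::zero^4) $ 4 = d"
  by (simp_all add: vector_def)

lemma A1_in_GL4Z: "A1 \<kappa> r \<in> carrier GL4Z"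
proof -
  define A' :: "int^4^4" where "A' = vector [vector [1, 0, 0, 0],
    vector [- s_coeff \<kappa> * r, (if \<kappa> = Type_B then 0 else - 1), - 1, 0],
    vector [0, 1, 0, 0],
    vector [r, 1, 0, 1]]"
  have "A1 \<kappa> r ** A' = mat 1 \<and> A' ** A1 \<kappa> r = mat 1"
    by (cases \<kappa>)
       (simp_all add: A'_def vec_eq_iff forall_4 matrix_matrix_mult_def sum_4 mat_def)
  then show ?thesis
    by (auto simp: GL4Z_def invertible_def)
qed

lemma A2_in_GL4Z: "A2 \<in> carrier GL4Z"
proof -
  define A' :: "int^4^4" where "A' = vector [vector [1, 0, 0, 0],
    vector [0, 0, 1, 0],
    vector [0, - 1, 1, 0],
    vector [0, 0, 0, 1]]"
  have "A2 ** A' = mat 1 \<and> A' ** A2 = mat 1"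
    by (simp add: A'_def A2_def vec_eq_iff forall_4 matrix_matrix_mult_def sum_4 mat_def)
  then show ?thesis
    by (auto simp: GL4Z_def invertible_def)
qed

end

theory Submission
  imports Defs
begin

text \<open>
  A finite-index subgroup contains a positive power of every element of the group. The group contains
  the translations \<open>T\<^sub>w\<close>, \<open>T\<^sub>u\<close> and a central one; they differ from the identity by a square-zero
  matrix, so being fixed by (or commuting with) a power of them amounts to the same linear condition as
  for the translation itself. The translations determine everything except, for the forms, the
  coefficients of \<open>\<gamma>\<^sup>* \<and> u\<^sup>*\<close> and \<open>\<gamma>\<^sup>* \<and> w\<^sup>*\<close> and, for the centralizer, a translation
  part; these are killed by the powers of \<open>A\<^sub>1 A\<^sub>2\<close> and \<open>A\<^sub>2 A\<^sub>1\<close>, whose middle blocks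
  are opposite elementary matrices.
\<close>

section \<open>Powers in finite-index subgroups\<close>

text \<open>Pigeonhole: with finitely many cosets, two powers \<open>x [^] i\<close> and
  \<open>x [^] j\<close> share one, and then \<open>x [^] (j - i)\<close> lies in
  \<open>H\<close>.\<close>

lemma (in group) finite_index_power_mem:
  assumes "subgroup H G" "finite (rcosets H)" "x \<in> carrier G"
  obtains n :: nat where "n > 0" "x [^] n \<in> H"
proof -
  have "\<not> inj (\<lambda>i::nat. H #> (x [^] i))"
  proof
    assume inj: "inj (\<lambda>i::nat. H #> (x [^] i))"
    have "range (\<lambda>i::nat. H #> (x [^] i)) \<subseteq> rcosets H"
      using assms(3) by (auto simp: RCOSETS_def)
    then show False
      using inj assms(2) finite_imageD finite_subset infinite_UNIV_nat by metis
  qed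
  then obtain i j :: nat where ij: "i < j" "H #> (x [^] i) = H #> (x [^] j)"
    unfolding inj_def by (metis linorder_neqE_nat)
  have "x [^] j \<in> H #> (x [^] i)"
    using ij(2) assms by (metis rcos_self nat_pow_closed)
  then obtain h where h: "h \<in> H" "x [^] j = h \<otimes> x [^] i"
    by (auto simp: r_coset_def)
  have "x [^] j = x [^] (j - i) \<otimes> x [^] i"
    using ij(1) assms(3) by (simp add: nat_pow_mult)
  then have "x [^] (j - i) = h"
    using h assms(1,3) by (metis nat_pow_closed right_cancel subgroup.mem_carrier)
  with h(1) ij(1) show thesis
    by (intro that[of "j - i"]) auto
qed

section \<open>The matrix group and its action on the lattice\<close>

lemma GL4Z_simps [simp]:
  "carrier GL4Z = {A. invertible A}" "a \<otimes>\<^bsub>GL4Z\<^esub> b = a ** b" "\<one>\<^bsub>GL4Z\<^esub> = mat 1"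
  by (simp_all add: GL4Z_def)

lemma matrix_inv_mult:
  fixes A :: "int^4^4"
  assumes "invertible A"
  shows "A ** matrix_inv A = mat 1" "matrix_inv A ** A = mat 1"
proof -
  have "A ** matrix_inv A = mat 1 \<and> matrix_inv A ** A = mat 1"
    unfolding matrix_inv_def by (rule someI_ex) (use assms in \<open>simp add: invertible_def\<close>)
  then show "A ** matrix_inv A = mat 1" "matrix_inv A ** A = mat 1"
    by auto
qed

lemma inv_GL4Z:
  assumes "invertible A"
  shows "inv\<^bsub>GL4Z\<^esub> A = matrix_inv A"
proof -
  have "invertible (matrix_inv A)"
    using matrix_inv_mult[OF assms] by (auto simp: invertible_def)
  then show ?thesis
    using assms matrix_inv_mult[OF assms] by (intro group.inv_equality[OF group_GL4Z]) auto
qed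

lemma act_mult: "act (g ** h) x = act g (act h x)"
  by (simp add: act_def vec_eq_iff matrix_matrix_mult_def matrix_vector_mult_def sum_4 algebra_simps)

lemma act_one [simp]: "act (mat 1) x = x"
  by (simp add: act_def vec_eq_iff forall_4 matrix_vector_mult_def sum_4 mat_def)

lemma act_inv:
  assumes "invertible g"
  shows "act g (act (matrix_inv g) x) = x" "act (matrix_inv g) (act g x) = x"
  using assms by (simp_all add: act_mult[symmetric] matrix_inv_mult)

lemma calG_subgroup: "subgroup (calG \<kappa> r) GL4Z"
  unfolding calG_def
  using A1_in_GL4Z[of \<kappa> r] A2_in_GL4Z by (intro group.generate_is_subgroup[OF group_GL4Z]) auto

text \<open>The rule \<open>generate.induct\<close> is recast with closure under
  \<open>matrix_inv\<close>, so that invariance has to be computed only for the two generators and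
  never for their inverses.\<close>

lemma calG_induct [consumes 1, case_names one A1 A2 mult inv]:
  assumes "g \<in> calG \<kappa> r"
    and "P (mat 1)" "P (A1 \<kappa> r)" "P A2"
    and mult: "\<And>a b. P a \<Longrightarrow> P b \<Longrightarrow> P (a ** b)"
    and inv: "\<And>a. invertible a \<Longrightarrow> P a \<Longrightarrow> P (matrix_inv a)"
  shows "P g"
  using assms(1) unfolding calG_def
proof (induction rule: generate.induct)
  case (inv h)
  then have "invertible h"
    using A1_in_GL4Z[of \<kappa> r] A2_in_GL4Z by auto
  then show ?case
    using inv assms(3,4) by (auto simp: inv_GL4Z intro!: assms(6))
qed (use assms in auto)

section \<open>Block matrices and their powers\<close>

text \<open>The general matrix fixing both \<delta> and the functional \<open>\<gamma>_star\<close>;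
  the middle block acts on u and w.\<close>

definition blk :: "int \<Rightarrow> int \<Rightarrow> int \<Rightarrow> int \<Rightarrow> int \<Rightarrow> int \<Rightarrow> int \<Rightarrow> int \<Rightarrow> int \<Rightarrow> int^4^4" where
  "blk a b m11 m12 m21 m22 c d e =
    vector [vector [1, 0, 0, 0],
            vector [a, m11, m12, 0],
            vector [b, m21, m22, 0],
            vector [c, d, e, 1]]"

lemma blk_mult:
  "blk a b m11 m12 m21 m22 c d e ** blk a' b' n11 n12 n21 n22 c' d' e' =
    blk (a + m11 * a' + m12 * b') (b + m21 * a' + m22 * b')
      (m11 * n11 + m12 * n21) (m11 * n12 + m12 * n22)
      (m21 * n11 + m22 * n21) (m21 * n12 + m22 * n22)
      (c + d * a' + e * b' + c') (d * n11 + e * n21 + d') (d * n12 + e * n22 + e')"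
  by (simp add: blk_def vec_eq_iff forall_4 matrix_matrix_mult_def sum_4)

lemma mat_1_blk: "mat 1 = blk 0 0 1 0 0 1 0 0 0"
  by (simp add: blk_def vec_eq_iff forall_4 mat_def)

text \<open>The entry \<open>2 - s_coeff \<kappa>\<close> is 0 for type B and -1 for type C, so one
  formula serves both types.\<close>

lemma A1_blk:
  "A1 \<kappa> r = blk 0 (- s_coeff \<kappa> * r) 0 1 (- 1) (2 - s_coeff \<kappa>) (- r) 0 (- 1)"
  by (cases \<kappa>) (simp_all add: blk_def)

lemma A2_blk: "A2 = blk 0 0 1 (- 1) 1 0 0 0 0"
  by (simp add: A2_def blk_def)

lemma act_blk:
  "act (blk a b m11 m12 m21 m22 c d e) x = vector [x $ 1,
    of_int a * x $ 1 + of_int m11 * x $ 2 + of_int m12 * x $ 3,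
    of_int b * x $ 1 + of_int m21 * x $ 2 + of_int m22 * x $ 3,
    of_int c * x $ 1 + of_int d * x $ 2 + of_int e * x $ 3 + x $ 4]"
  by (simp add: act_def blk_def vec_eq_iff forall_4 matrix_vector_mult_def sum_4)

lemma invertible_blk_translation: "invertible (blk a b 1 0 0 1 c d e)"
  unfolding invertible_def
  by (rule exI[of _ "blk (- a) (- b) 1 0 0 1 (d * a + e * b - c) (- d) (- e)"])
     (simp add: blk_mult mat_1_blk)

text \<open>Writing the matrix as 1 + N, the only entry of N^2 that can be nonzero is
  \<open>d * a + e * b\<close>; the assumption makes N square-zero, whence (1 + N)^n = 1 +
  nN.\<close>

lemma power_translation:
  assumes "d * a + e * b = 0"
  shows "blk a b 1 0 0 1 c d e [^]\<^bsub>GL4Z\<^esub> (n::nat) =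
    blk (int n * a) (int n * b) 1 0 0 1 (int n * c) (int n * d) (int n * e)"
proof (induction n)
  case (Suc n)
  have "int n * (d * a + e * b) = 0"
    using assms by simp
  then show ?case
    using Suc by (simp add: blk_mult algebra_simps)
qed (simp add: mat_1_blk)

text \<open>Only the middle block is tracked; the other entries cancel where the power is
  applied.\<close>

lemma power_lower:
  "\<exists>a' b' c' d' e'. blk a b 1 0 k 1 c d e [^]\<^bsub>GL4Z\<^esub> (n::nat) = blk a' b' 1 0 (int n * k) 1 c' d' e'"
proof (induction n)
  case (Suc n)
  then show ?case
    by (auto simp: blk_mult algebra_simps) metis
next
  case 0
  show ?case
    by (rule exI[of _ 0])+ (simp add: mat_1_blk)
qed

lemma power_upper:
  "\<exists>a' b' c' d' e'. blk a b 1 k 0 1 c d e [^]\<^bsub>GL4Z\<^esub> (n::nat) = blk a' b' 1 (int n * k) 0 1 c' d' e'"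
proof (induction n)
  case (Suc n)
  then show ?case
    by (auto simp: blk_mult algebra_simps) metis
next
  case 0
  show ?case
    by (rule exI[of _ 0])+ (simp add: mat_1_blk)
qed

section \<open>Translations and shears in the group and in \<open>H\<close>\<close>

text \<open>Exhibits x as the quotient of g' by g through a product identity, so commutators and
  conjugates need no explicit inverses.\<close>

lemma calG_left_factor:
  assumes "g \<in> calG \<kappa> r" "g' \<in> calG \<kappa> r" "invertible x" "x ** g = g'"
  shows "x \<in> calG \<kappa> r"
proof -
  interpret calG: subgroup "calG \<kappa> r" GL4Z by (rule calG_subgroup)
  have inv: "invertible g"
    using calG.subset assms(1) by auto
  have "x = x ** (g ** matrix_inv g)"
    by (simp add: matrix_inv_mult inv)
  also have "\<dots> = g' ** matrix_inv g"
    by (simp add: assms(4) matrix_mul_assoc)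
  finally show ?thesis
    using calG.m_closed[OF assms(2) calG.m_inv_closed[OF assms(1)]] inv by (simp add: inv_GL4Z)
qed

lemma calG_elements:
  defines "m \<equiv> \<lambda>\<kappa> r. 2 * s_coeff \<kappa> * r"
  shows calG_translation_w: "blk 0 (- m \<kappa> r) 1 0 0 1 0 (- 2) 0 \<in> calG \<kappa> r"
    and calG_translation_u: "blk (m \<kappa> r) 0 1 0 0 1 0 0 (- 2) \<in> calG \<kappa> r"
    and calG_central: "blk 0 0 1 0 0 1 (- 4 * m \<kappa> r) 0 0 \<in> calG \<kappa> r"
    and calG_lower: "A1 \<kappa> r ** A2 \<in> calG \<kappa> r"
    and calG_upper: "A2 ** A1 \<kappa> r \<in> calG \<kappa> r"
proof -
  have A: "A1 \<kappa> r \<in> calG \<kappa> r" "A2 \<in> calG \<kappa> r"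
    by (auto simp: calG_def intro: generate.incl)
  have mult: "a ** b \<in> calG \<kappa> r" if "a \<in> calG \<kappa> r" "b \<in> calG \<kappa> r" for a b
    using subgroup.m_closed[OF calG_subgroup that] by simp
  let ?J = "A2 ** A2 ** A2"
  let ?Tw = "blk 0 (- m \<kappa> r) 1 0 0 1 0 (- 2) 0"
  let ?Tu = "blk (m \<kappa> r) 0 1 0 0 1 0 0 (- 2)"
  \<comment> \<open>\<open>J\<close> negates \<open>u\<close> and \<open>w\<close>, so the commutator \<open>T\<^sub>w = A\<^sub>1 J A\<^sub>1\<^sup>-\<^sup>1 J\<close> is a translation;
    \<open>T\<^sub>u\<close> is its conjugate by \<open>A\<^sub>2\<close>, and \<open>T\<^sub>u\<close>, \<open>T\<^sub>w\<close> have a central commutator.\<close>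
  show w: "?Tw \<in> calG \<kappa> r"
  proof (rule calG_left_factor)
    show "?J ** A1 \<kappa> r \<in> calG \<kappa> r" "A1 \<kappa> r ** ?J \<in> calG \<kappa> r"
      by (intro mult A)+
    show "?Tw ** (?J ** A1 \<kappa> r) = A1 \<kappa> r ** ?J"
      by (simp add: A1_blk A2_blk blk_mult m_def algebra_simps)
  qed (rule invertible_blk_translation)
  show u: "?Tu \<in> calG \<kappa> r"
  proof (rule calG_left_factor[of A2])
    show "A2 ** ?Tw \<in> calG \<kappa> r"
      by (intro mult A w)
    show "?Tu ** A2 = A2 ** ?Tw"
      by (simp add: A2_blk blk_mult)
  qed (rule A invertible_blk_translation)+
  show "blk 0 0 1 0 0 1 (- 4 * m \<kappa> r) 0 0 \<in> calG \<kappa> r"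
  proof (rule calG_left_factor)
    show "?Tu ** ?Tw \<in> calG \<kappa> r" "?Tw ** ?Tu \<in> calG \<kappa> r"
      by (intro mult w u)+
    show "blk 0 0 1 0 0 1 (- 4 * m \<kappa> r) 0 0 ** (?Tu ** ?Tw) = ?Tw ** ?Tu"
      by (simp add: blk_mult)
  qed (rule invertible_blk_translation)
  show "A1 \<kappa> r ** A2 \<in> calG \<kappa> r" "A2 ** A1 \<kappa> r \<in> calG \<kappa> r"
    by (intro mult A)+
qed

lemma s_coeff_bounds: "s_coeff \<kappa> \<ge> 2"
  by (cases \<kappa>) auto

lemma finite_index_calG:
  assumes "finite_index_subgroup H (GL4Z\<lparr>carrier := calG \<kappa> r\<rparr>)"
  shows finite_index_calG_subgroup: "subgroup H GL4Z"
    and finite_index_calG_subset: "H \<subseteq> calG \<kappa> r"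
    and finite_index_calG_power:
      "g \<in> calG \<kappa> r \<Longrightarrow> \<exists>n>0. g [^]\<^bsub>GL4Z\<^esub> (n::nat) \<in> H"
proof -
  let ?K = "GL4Z\<lparr>carrier := calG \<kappa> r\<rparr>"
  have K: "group ?K"
    by (rule group.subgroup_imp_group[OF group_GL4Z calG_subgroup])
  have H: "subgroup H ?K" "finite (rcosets\<^bsub>?K\<^esub> H)"
    using assms by (auto simp: finite_index_subgroup_def)
  show "subgroup H GL4Z"
    by (rule group.incl_subgroup[OF group_GL4Z calG_subgroup H(1)])
  show "H \<subseteq> calG \<kappa> r"
    using subgroup.subset[OF H(1)] by simp
  show "\<exists>n>0. g [^]\<^bsub>GL4Z\<^esub> (n::nat) \<in> H" if "g \<in> calG \<kappa> r"
  proof -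
    obtain n :: nat where "n > 0" "g [^]\<^bsub>?K\<^esub> n \<in> H"
      using group.finite_index_power_mem[OF K H, of g] \<open>g \<in> calG \<kappa> r\<close> by auto
    then show ?thesis
      by (auto simp: monoid.nat_pow_consistent[OF group.is_monoid[OF group_GL4Z], symmetric])
  qed
qed

text \<open>Powers of the elements in \<open>calG_elements\<close>; the factor 2 is absorbed into
  \<open>l\<close> and \<open>m\<close>. The corner \<open>n\<close> is a negative multiple of
  \<open>s_coeff \<kappa> * r\<close>, nonzero because r \<ge> 1.\<close>

lemma finite_index_translations:
  assumes "r \<ge> 1" "finite_index_subgroup H (GL4Z\<lparr>carrier := calG \<kappa> r\<rparr>)"
  obtains l m n
  where "l > 0" "blk 0 (- s_coeff \<kappa> * r * l) 1 0 0 1 0 (- l) 0 \<in> H"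
    and "m > 0" "blk (s_coeff \<kappa> * r * m) 0 1 0 0 1 0 0 (- m) \<in> H"
    and "n \<noteq> 0" "blk 0 0 1 0 0 1 n 0 0 \<in> H"
proof -
  note pow = finite_index_calG_power[OF assms(2)]
  obtain l where l: "l > 0" "blk 0 (- (2 * s_coeff \<kappa> * r)) 1 0 0 1 0 (- 2) 0 [^]\<^bsub>GL4Z\<^esub> (l::nat) \<in> H"
    using pow[OF calG_translation_w] by auto
  obtain m where m: "m > 0" "blk (2 * s_coeff \<kappa> * r) 0 1 0 0 1 0 0 (- 2) [^]\<^bsub>GL4Z\<^esub> (m::nat) \<in> H"
    using pow[OF calG_translation_u] by auto
  obtain n where n: "n > 0"
    "blk 0 0 1 0 0 1 (- 4 * (2 * s_coeff \<kappa> * r)) 0 0 [^]\<^bsub>GL4Z\<^esub> (n::nat) \<in> H"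
    using pow[OF calG_central] by auto
  show thesis
  proof (rule that)
    show "0 < 2 * int l" "0 < 2 * int m" "int n * (- 4 * (2 * s_coeff \<kappa> * r)) \<noteq> 0"
      using l m n assms(1) s_coeff_bounds[of \<kappa>] by auto
    show "blk 0 (- s_coeff \<kappa> * r * (2 * int l)) 1 0 0 1 0 (- (2 * int l)) 0 \<in> H"
      using l(2) by (simp add: power_translation mult_ac)
    show "blk (s_coeff \<kappa> * r * (2 * int m)) 0 1 0 0 1 0 0 (- (2 * int m)) \<in> H"
      using m(2) by (simp add: power_translation mult_ac)
    show "blk 0 0 1 0 0 1 (int n * (- 4 * (2 * s_coeff \<kappa> * r))) 0 0 \<in> H"
      using n(2) by (simp add: power_translation)
  qed
qed

text \<open>The products of the two generators have unipotent middle blocks with off-diagonal entry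
  1 - s or s - 1, nonzero since s \<ge> 2.\<close>

lemma finite_index_shears:
  assumes "finite_index_subgroup H (GL4Z\<lparr>carrier := calG \<kappa> r\<rparr>)"
  obtains k k' a b c d e a' b' c' d' e'
  where "k \<noteq> 0" "blk a b 1 0 k 1 c d e \<in> H"
    and "k' \<noteq> 0" "blk a' b' 1 k' 0 1 c' d' e' \<in> H"
proof -
  note pow = finite_index_calG_power[OF assms]
  obtain p where p: "p > 0" "(A1 \<kappa> r ** A2) [^]\<^bsub>GL4Z\<^esub> (p::nat) \<in> H"
    using pow[OF calG_lower] by auto
  obtain p' where p': "p' > 0" "(A2 ** A1 \<kappa> r) [^]\<^bsub>GL4Z\<^esub> (p'::nat) \<in> H"
    using pow[OF calG_upper] by auto
  have A12: "A1 \<kappa> r ** A2 = blk 0 (- s_coeff \<kappa> * r) 1 0 (1 - s_coeff \<kappa>) 1 (- r) (- 1) 0"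
    by (simp add: A1_blk A2_blk blk_mult)
  have A21: "A2 ** A1 \<kappa> r = blk (s_coeff \<kappa> * r) 0 1 (s_coeff \<kappa> - 1) 0 1 (- r) 0 (- 1)"
    by (simp add: A1_blk A2_blk blk_mult)
  obtain a b c d e where lower: "blk a b 1 0 (int p * (1 - s_coeff \<kappa>)) 1 c d e \<in> H"
    using p(2) power_lower[of _ _ "1 - s_coeff \<kappa>" _ _ _ p] unfolding A12 by metis
  obtain a' b' c' d' e' where upper: "blk a' b' 1 (int p' * (s_coeff \<kappa> - 1)) 0 1 c' d' e' \<in> H"
    using p'(2) power_upper[of _ _ "s_coeff \<kappa> - 1" _ _ _ p'] unfolding A21 by metis
  have "int p * (1 - s_coeff \<kappa>) \<noteq> 0" "int p' * (s_coeff \<kappa> - 1) \<noteq> 0"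
    using p p' s_coeff_bounds[of \<kappa>] by auto
  then show thesis
    using lower upper that by blast
qed

section \<open>Objects fixed by the whole group\<close>

lemma calG_q_tilde:
  fixes x y :: "'a::comm_ring_1^4"
  assumes "g \<in> calG \<kappa> r"
  shows "q_tilde \<kappa> r (act g x) (act g y) = q_tilde \<kappa> r x y"
  using assms
proof (induction arbitrary: x y rule: calG_induct)
  case A1
  show ?case
    by (cases \<kappa>) (simp_all add: A1_blk act_blk q_tilde_def wedge_def coord_def algebra_simps)
next
  case A2
  show ?case
    by (simp add: A2_blk act_blk q_tilde_def wedge_def coord_def algebra_simps)
next
  case (inv a)
  show ?case
    \<comment> \<open>Invariance under \<open>a\<close> at the preimages of x and y is invariance
      under the inverse at x and y.\<close>
    using inv(2)[of "act (matrix_inv a) x" "act (matrix_inv a) y"] inv(1) by (simp add: act_inv)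
qed (simp_all add: act_mult)

lemma calG_gamma_star:
  fixes x :: "'a::comm_ring_1^4"
  assumes "g \<in> calG \<kappa> r"
  shows "act g x $ 1 = x $ 1"
  using assms
proof (induction arbitrary: x rule: calG_induct)
  case (inv a)
  show ?case
    using inv(2)[of "act (matrix_inv a) x"] inv(1) by (simp add: act_inv)
qed (simp_all add: act_mult A1_blk A2_blk act_blk)

lemma calG_delta:
  assumes "g \<in> calG \<kappa> r"
  shows "act g (axis 4 1 :: 'a::comm_ring_1^4) = axis 4 1"
  using assms
proof (induction rule: calG_induct)
  case (inv a)
  then show ?case
    using act_inv(2)[OF inv(1), of "axis 4 1 :: 'a^4"] by simp
next
  case A1
  show ?case
    by (simp add: A1_blk act_blk vec_eq_iff forall_4 axis_def)
next
  case A2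
  show ?case
    by (simp add: A2_blk act_blk vec_eq_iff forall_4 axis_def)
qed (simp_all add: act_mult)

lemma axis_nth_if: "axis i x $ j = (if j = i then x else 0)"
  by (simp add: axis_def)

lemma act_scale: "act g (t *s x) = t *s act g x"
  by (simp add: act_def vec_eq_iff matrix_vector_mult_def sum_distrib_left mult_ac)

lemma act_axis: "act g (axis j 1) $ i = of_int (g $ i $ j)"
  by (simp add: act_def axis_def matrix_vector_mult_def if_distrib cong: if_cong)

text \<open>\<open>E41\<close> is the rank-one map sending x to \<open>\<gamma>_star x\<close> times
  \<delta>, and g fixes both the functional and the vector.\<close>

lemma calG_commutes_E41:
  assumes "g \<in> calG \<kappa> r"
  shows "g ** E41 = E41 ** g"
proof -
  have "g $ 1 $ j = (if j = 1 then 1 else 0)" for j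
    using calG_gamma_star[OF assms, of "axis j (1::int)"] by (auto simp: act_axis axis_nth_if)
  moreover have "g $ i $ 4 = (if i = 4 then 1 else 0)" for i
    using arg_cong[OF calG_delta[OF assms, where 'a = int], of "\<lambda>v. v $ i"]
    by (simp add: act_axis axis_nth_if)
  ultimately show ?thesis
    by (simp add: vec_eq_iff forall_4 matrix_matrix_mult_def sum_4 E41_def)
qed

lemma act_ext_square_fixed_iff:
  assumes "invertible g"
  shows "act_ext_square g \<omega> = \<omega> \<longleftrightarrow> (\<forall>x y. \<omega> (act g x) (act g y) = \<omega> x y)"
  using assms by (auto simp: fun_eq_iff act_ext_square_def) (metis act_inv)+

lemma act_dual_fixed_iff:
  assumes "invertible g"
  shows "act_dual g f = f \<longleftrightarrow> (\<forall>x. f (act g x) = f x)"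
  using assms by (auto simp: fun_eq_iff act_dual_def) (metis act_inv)+

lemma q_tilde_ext_square: "(\<lambda>x y. t * q_tilde \<kappa> r x y) \<in> ext_square_dual"
  by (simp add: ext_square_dual_def module_hom_iff_linear q_tilde_def wedge_def coord_def algebra_simps)

section \<open>Invariants and centralizer of a finite-index subgroup\<close>

context
  fixes r :: int and \<kappa> :: kappa and H :: "(int^4^4) set"
  assumes r: "r \<ge> 1" and H: "finite_index_subgroup H (GL4Z\<lparr>carrier := calG \<kappa> r\<rparr>)"
begin

lemma H_invertible: "h \<in> H \<Longrightarrow> invertible h"
  using subgroup.subset[OF finite_index_calG_subgroup[OF H]] by auto

text \<open>An integral domain of characteristic zero is what cancelling nonzero integer factors
  requires; integers and reals are both instances.\<close>

lemma invariant_forms: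
  "invariants act_ext_square H ext_square_dual
    = {\<lambda>x y. t * q_tilde \<kappa> r x y | t :: 'a::{idom, ring_char_0}. True}"
proof (intro equalityI subsetI)
  fix \<omega> :: "'a^4 \<Rightarrow> 'a^4 \<Rightarrow> 'a"
  assume \<omega>: "\<omega> \<in> invariants act_ext_square H ext_square_dual"
  then have "\<omega> \<in> ext_square_dual"
    by (simp add: invariants_def)
  then obtain c12 c13 c14 c23 c24 c34 where c: "\<And>x y. \<omega> x y =
        c12 * (coord 1 \<and>\<^sub>2 coord 2) x y + c13 * (coord 1 \<and>\<^sub>2 coord 3) x y
      + c14 * (coord 1 \<and>\<^sub>2 coord 4) x y + c23 * (coord 2 \<and>\<^sub>2 coord 3) x y
      + c24 * (coord 2 \<and>\<^sub>2 coord 4) x y + c34 * (coord 3 \<and>\<^sub>2 coord 4) x y"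
    unfolding ext_square_basis by (auto dest!: ex1_implies_ex)
  have inv: "\<omega> (act h x) (act h y) = \<omega> x y" if "h \<in> H" for h x y
    using \<omega> that act_ext_square_fixed_iff[OF H_invertible[OF that]] by (auto simp: invariants_def)
  obtain l m n
    where trans: "l > 0" "blk 0 (- s_coeff \<kappa> * r * l) 1 0 0 1 0 (- l) 0 \<in> H"
      "m > 0" "blk (s_coeff \<kappa> * r * m) 0 1 0 0 1 0 0 (- m) \<in> H"
      "n \<noteq> 0" "blk 0 0 1 0 0 1 n 0 0 \<in> H"
    using finite_index_translations[OF r H] .
  obtain k k' a b c d e a' b' c' d' e'
    where shears: "k \<noteq> 0" "blk a b 1 0 k 1 c d e \<in> H"
      "k' \<noteq> 0" "blk a' b' 1 k' 0 1 c' d' e' \<in> H"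
    using finite_index_shears[OF H] .
  \<comment> \<open>The central translation sends \<gamma> to \<gamma> + n\<delta> and fixes u and
    w, so \<omega> vanishes on (\<delta>, u) and (\<delta>, w).\<close>
  have c24: "c24 = 0" and c34: "c34 = 0"
    using inv[OF trans(6), of "axis 1 1" "axis 2 1"] inv[OF trans(6), of "axis 1 1" "axis 3 1"] trans(5)
    by (simp_all add: c wedge_def coord_def act_blk axis_def)
  \<comment> \<open>This translation sends \<gamma> to \<gamma> - srl w and u to u - l\<delta>;
    compare \<omega>(\<gamma>, u) before and after.\<close>
  have "of_int l * (c14 - of_int (s_coeff \<kappa> * r) * c23) = 0"
    using inv[OF trans(2), of "axis 1 1" "axis 2 1"] c24 c34
    by (auto simp: c wedge_def coord_def act_blk axis_def algebra_simps)
  then have c14: "c14 = of_int (s_coeff \<kappa> * r) * c23"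
    using trans(1) by simp
  have \<omega>_q: "\<omega> x y = c12 * (coord 1 \<and>\<^sub>2 coord 2) x y + c13 * (coord 1 \<and>\<^sub>2 coord 3) x y
      + c23 * q_tilde \<kappa> r x y" for x y
    by (simp add: c c24 c34 c14 q_tilde_def algebra_simps)
  \<comment> \<open>The \<open>q_tilde\<close> part is invariant, so the remainder is invariant on
    its own.\<close>
  have inv': "c12 * (coord 1 \<and>\<^sub>2 coord 2) (act h x) (act h y) + c13 * (coord 1 \<and>\<^sub>2 coord 3) (act h x) (act h y)
      = c12 * (coord 1 \<and>\<^sub>2 coord 2) x y + c13 * (coord 1 \<and>\<^sub>2 coord 3) x y" if "h \<in> H" for h x y
    using inv[OF that, of x y] that finite_index_calG_subset[OF H]
    by (auto simp: \<omega>_q calG_q_tilde subset_eq)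
  \<comment> \<open>Modulo \<delta>, which the remainder ignores, the lower shear sends u to u + kw
    and the upper one sends w to w + k'u; pairing with \<gamma> gives k c13 = 0 and k' c12 =
    0.\<close>
  have "c13 = 0"
    using inv'[OF shears(2), of "axis 1 1" "axis 2 1"] shears(1)
    by (simp add: wedge_def coord_def act_blk axis_def)
  moreover have "c12 = 0"
    using inv'[OF shears(4), of "axis 1 1" "axis 3 1"] shears(3)
    by (simp add: wedge_def coord_def act_blk axis_def)
  ultimately have "\<omega> = (\<lambda>x y. c23 * q_tilde \<kappa> r x y)"
    by (simp add: fun_eq_iff \<omega>_q)
  then show "\<omega> \<in> {\<lambda>x y. t * q_tilde \<kappa> r x y | t. True}"
    by blast
next
  fix \<omega> :: "'a^4 \<Rightarrow> 'a^4 \<Rightarrow> 'a"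
  assume "\<omega> \<in> {\<lambda>x y. t * q_tilde \<kappa> r x y | t. True}"
  then show "\<omega> \<in> invariants act_ext_square H ext_square_dual"
    using finite_index_calG_subset[OF H]
    by (auto simp: invariants_def q_tilde_ext_square act_ext_square_fixed_iff H_invertible
        calG_q_tilde subset_eq)
qed

lemma invariant_vectors: "invariants act H UNIV = {n *s \<delta>_vec | n :: int. True}"
proof (intro equalityI subsetI)
  fix x :: "int^4"
  assume "x \<in> invariants act H UNIV"
  then have inv: "act h x = x" if "h \<in> H" for h
    using that by (simp add: invariants_def)
  obtain l m n
    where trans: "l > 0" "blk 0 (- s_coeff \<kappa> * r * l) 1 0 0 1 0 (- l) 0 \<in> H"
      "m > 0" "blk (s_coeff \<kappa> * r * m) 0 1 0 0 1 0 0 (- m) \<in> H"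
      "n \<noteq> 0" "blk 0 0 1 0 0 1 n 0 0 \<in> H"
    using finite_index_translations[OF r H] .
  \<comment> \<open>The three translations change the \<delta>-coordinate of x by -l x2, -m x3 and n
    x1.\<close>
  have "x $ 1 = 0" "x $ 2 = 0" "x $ 3 = 0"
    using inv[OF trans(2)] inv[OF trans(4)] inv[OF trans(6)] trans(1,3,5)
    by (auto simp: act_blk vec_eq_iff forall_4)
  then have "x = x $ 4 *s \<delta>_vec"
    by (simp add: vec_eq_iff forall_4 axis_def)
  then show "x \<in> {n *s \<delta>_vec | n. True}"
    by blast
next
  fix x :: "int^4"
  assume "x \<in> {n *s \<delta>_vec | n. True}"
  then show "x \<in> invariants act H UNIV"
    using finite_index_calG_subset[OF H]
    by (auto simp: invariants_def act_scale calG_delta subset_eq)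
qed

lemma invariant_covectors: "invariants act_dual H dual = {\<lambda>x. n * \<gamma>_star x | n :: int. True}"
proof (intro equalityI subsetI)
  fix f :: "int^4 \<Rightarrow> int"
  assume f: "f \<in> invariants act_dual H dual"
  then have "f \<in> dual"
    by (simp add: invariants_def)
  then have f_add: "f (x + y) = f x + f y" and f_scale: "f (t *s x) = t * f x" for x y t
    by (auto simp: dual_def module_hom_iff_linear)
  have f_coord: "f x = x $ 1 * f (axis 1 1) + x $ 2 * f (axis 2 1) + x $ 3 * f (axis 3 1)
      + x $ 4 * f (axis 4 1)" for x
    by (subst vec4_expand) (simp only: f_add f_scale)
  have inv: "f (act h x) = f x" if "h \<in> H" for h x
    using f that act_dual_fixed_iff[OF H_invertible[OF that]] by (auto simp: invariants_def)
  obtain l m n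
    where trans: "l > 0" "blk 0 (- s_coeff \<kappa> * r * l) 1 0 0 1 0 (- l) 0 \<in> H"
      "m > 0" "blk (s_coeff \<kappa> * r * m) 0 1 0 0 1 0 0 (- m) \<in> H"
      "n \<noteq> 0" "blk 0 0 1 0 0 1 n 0 0 \<in> H"
    using finite_index_translations[OF r H] .
  \<comment> \<open>The translations move \<gamma> by nonzero multiples of \<delta>, w and u in
    turn, and f must vanish on each difference.\<close>
  have f4: "f (axis 4 1) = 0"
    using inv[OF trans(6), of "axis 1 1", unfolded f_coord[of "act _ _"]] trans(5)
    by (simp add: act_blk axis_nth_if)
  have f3: "f (axis 3 1) = 0"
    using inv[OF trans(2), of "axis 1 1", unfolded f_coord[of "act _ _"]] trans(1) r s_coeff_bounds[of \<kappa>]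
    by (simp add: act_blk axis_nth_if f4)
  have f2: "f (axis 2 1) = 0"
    using inv[OF trans(4), of "axis 1 1", unfolded f_coord[of "act _ _"]] trans(3) r s_coeff_bounds[of \<kappa>]
    by (simp add: act_blk axis_nth_if f4 f3)
  have "f = (\<lambda>x. f (axis 1 1) * \<gamma>_star x)"
    by (rule ext, subst f_coord) (simp add: f2 f3 f4 coord_def)
  then show "f \<in> {\<lambda>x. n * \<gamma>_star x | n. True}"
    by blast
next
  fix f :: "int^4 \<Rightarrow> int"
  assume "f \<in> {\<lambda>x. n * \<gamma>_star x | n. True}"
  then show "f \<in> invariants act_dual H dual"
    using finite_index_calG_subset[OF H]
    by (auto simp: invariants_def act_dual_fixed_iff H_invertible coord_def calG_gamma_star subset_eq
        dual_def module_hom_iff_linear algebra_simps)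
qed

lemma centralizer_finite_index:
  "centralizer GL4Z H = {mat \<epsilon> + mat n ** E41 | \<epsilon> n :: int. \<epsilon> = 1 \<or> \<epsilon> = - 1}"
proof (intro equalityI subsetI)
  fix X :: "int^4^4"
  assume "X \<in> centralizer GL4Z H"
  then have invX: "invertible X" and comm: "\<And>h. h \<in> H \<Longrightarrow> X ** h = h ** X"
    by (auto simp: centralizer_def)
  have eq: "(\<Sum>t\<in>UNIV. X $ i $ t * h $ t $ j) = (\<Sum>t\<in>UNIV. h $ i $ t * X $ t $ j)"
    if "h \<in> H" for h i j
    using comm[OF that] by (simp add: vec_eq_iff matrix_matrix_mult_def)
  note eq = eq[unfolded sum_4]
  obtain l m n
    where trans: "l > 0" "blk 0 (- s_coeff \<kappa> * r * l) 1 0 0 1 0 (- l) 0 \<in> H"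
      "m > 0" "blk (s_coeff \<kappa> * r * m) 0 1 0 0 1 0 0 (- m) \<in> H"
      "n \<noteq> 0" "blk 0 0 1 0 0 1 n 0 0 \<in> H"
    using finite_index_translations[OF r H] .
  obtain k k' a b c d e a' b' c' d' e'
    where shears: "k \<noteq> 0" "blk a b 1 0 k 1 c d e \<in> H"
      "k' \<noteq> 0" "blk a' b' 1 k' 0 1 c' d' e' \<in> H"
    using finite_index_shears[OF H] .
  have s: "s_coeff \<kappa> * r \<noteq> 0"
    using r s_coeff_bounds[of \<kappa>] by simp
  \<comment> \<open>Commuting with 1 + n \<open>E41\<close> means commuting with \<open>E41\<close>:
    the last column and first row of X are then zero off the diagonal.\<close>
  have Z: "X $ 1 $ 4 = 0" "X $ 2 $ 4 = 0" "X $ 3 $ 4 = 0" "X $ 4 $ 4 = X $ 1 $ 1"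
      "X $ 1 $ 2 = 0" "X $ 1 $ 3 = 0"
    using eq[OF trans(6), of 1 1] eq[OF trans(6), of 2 1] eq[OF trans(6), of 3 1] eq[OF trans(6), of 4 1]
      eq[OF trans(6), of 4 2] eq[OF trans(6), of 4 3] trans(5)
    by (simp_all add: blk_def)
  have Tw: "X $ 2 $ 3 = 0" "X $ 3 $ 3 = X $ 1 $ 1" "X $ 2 $ 2 = X $ 1 $ 1"
    using eq[OF trans(2), of 2 1] eq[OF trans(2), of 3 1] eq[OF trans(2), of 4 2] trans(1) s Z
    by (simp_all add: blk_def)
  have Tu: "X $ 3 $ 2 = 0"
    using eq[OF trans(4), of 3 1] trans(3) s Z by (simp add: blk_def)
  have "X $ 2 $ 1 = 0"
    using eq[OF shears(2), of 3 1] shears(1) Z Tw Tu by (simp add: blk_def)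
  moreover have "X $ 3 $ 1 = 0"
    using eq[OF shears(4), of 2 1] shears(3) Z Tw Tu by (simp add: blk_def)
  ultimately have X1: "X $ 2 $ 1 = 0" "X $ 3 $ 1 = 0" .
  \<comment> \<open>Entry (4,1) of the translation equations ties these entries to
    \<open>X $ 3 $ 1\<close> and \<open>X $ 2 $ 1\<close>, which the shears have already
    killed.\<close>
  have X4: "X $ 4 $ 2 = 0" "X $ 4 $ 3 = 0"
    using eq[OF trans(4), of 4 1] eq[OF trans(2), of 4 1] trans(1,3) s X1 Z Tw Tu
    by (simp_all add: blk_def)
  have "X = mat (X $ 1 $ 1) + mat (X $ 4 $ 1) ** E41"
    by (simp add: vec_eq_iff forall_4 mat_def E41_def matrix_matrix_mult_def sum_4 Z Tw Tu X1 X4)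
  moreover have "X $ 1 $ 1 = 1 \<or> X $ 1 $ 1 = - 1"
  proof -
    have "(X ** matrix_inv X) $ 1 $ 1 = 1"
      using matrix_inv_mult(1)[OF invX] by (simp add: mat_def)
    \<comment> \<open>The first row of X has a single nonzero entry, which is therefore a unit of
      the integers.\<close>
    then have "X $ 1 $ 1 * matrix_inv X $ 1 $ 1 = 1"
      by (simp add: matrix_matrix_mult_def sum_4 Z)
    then show ?thesis
      using zmult_eq_1_iff by blast
  qed
  ultimately show "X \<in> {mat \<epsilon> + mat n ** E41 | \<epsilon> n. \<epsilon> = 1 \<or> \<epsilon> = - 1}"
    by blast
next
  fix X :: "int^4^4"
  assume "X \<in> {mat \<epsilon> + mat n ** E41 | \<epsilon> n. \<epsilon> = 1 \<or> \<epsilon> = - 1}"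
  then obtain \<epsilon> n where X: "X = mat \<epsilon> + mat n ** E41" and \<epsilon>: "\<epsilon> = 1 \<or> \<epsilon> = - 1"
    by blast
  have distr: "(A + B) ** C = A ** C + B ** C" for A B C :: "int^4^4"
    by (simp add: vec_eq_iff matrix_matrix_mult_def sum.distrib algebra_simps)
  have scalar: "mat t ** A = A ** mat t" for t and A :: "int^4^4"
    by (simp add: vec_eq_iff forall_4 mat_def matrix_matrix_mult_def sum_4)
  \<comment> \<open>The inverse comes from \<open>E41\<close> being square-zero and \<epsilon>
    squaring to 1.\<close>
  have "X ** (mat \<epsilon> - mat n ** E41) = mat 1" "(mat \<epsilon> - mat n ** E41) ** X = mat 1"
    using \<epsilon> unfolding X
    by (auto simp: vec_eq_iff forall_4 mat_def E41_def matrix_matrix_mult_def sum_4)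
  then have "invertible X"
    by (auto simp: invertible_def)
  moreover have "X ** h = h ** X" if "h \<in> H" for h
  proof -
    have "E41 ** h = h ** E41"
      using calG_commutes_E41 finite_index_calG_subset[OF H] that by (metis subsetD)
    then have "mat n ** E41 ** h = h ** (mat n ** E41)"
      by (metis matrix_mul_assoc scalar)
    then show ?thesis
      by (simp add: X matrix_add_ldistrib distr scalar)
  qed
  ultimately show "X \<in> centralizer GL4Z H"
    by (simp add: centralizer_def)
qed

end

theorem theorem8p1:
  fixes r :: int and \<kappa> :: kappa and H :: "(int^4^4) set"
  assumes "r \<ge> 1"
    and "finite_index_subgroup H (GL4Z\<lparr>carrier := calG \<kappa> r\<rparr>)"
  shows "invariants act_ext_square H ext_square_dual = {\<lambda>x y. n * q_tilde \<kappa> r x y | n :: int. True}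
    \<and> invariants act_ext_square H ext_square_dual = {\<lambda>x y. t * q_tilde \<kappa> r x y | t :: real. True}
    \<and> invariants act H UNIV = {n *s \<delta>_vec | n :: int. True}
    \<and> invariants act_dual H dual = {\<lambda>x. n * \<gamma>_star x | n :: int. True}
    \<and> centralizer GL4Z H = {mat \<epsilon> + mat n ** E41 | \<epsilon> n :: int. \<epsilon> = 1 \<or> \<epsilon> = - 1}"
  \<comment> \<open>\<open>invariant_forms\<close> enters twice, for integer and for real
    coefficients.\<close>
  using invariant_forms[OF assms] invariant_forms[OF assms] invariant_vectors[OF assms]
    invariant_covectors[OF assms] centralizer_finite_index[OF assms]
  by (intro conjI)

end
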